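(* Given a system $\mathcal{P}(X,U)$ of linear DPPEs, there exists a linear perturbation $\phi$ such that the differential resultant $\partial\mathrm{CRes}(F_1^{\phi},\dots,F_n^{\phi})$ is a nonzero polynomial in $\mathbb{K}[p]\{X\}$ and $\det(S_n^{\phi})\neq 0$.
   Context: Setting. $\mathbb{K}$ is an ordinary differential field with derivation $\partial$, $n\ge 2$, $X=\{x_1,\dots,x_n\}$ and $U=\{u_1,\dots,u_{n-1}\}$ are sets of differential indeterminates over $\mathbb{K}$, $x_{ik}=\partial^kx_i$, $u_{jk}=\partial^ku_j$. $\mathrm{ord}(P,y)$ is the order of $P$ in $y$, equal to $-1$ if $P$ has no term in $y$ or its derivatives. "Linear" means of degree at most $1$. A system $\mathcal{P}(X,U)$ of linear DPPEs is $x_i=P_i(U)$, $i=1,\dots,n$, with $P_i\in\mathbb{K}\{U\}$ of degree at most $1$, not all in $\mathbb{K}$. Write $F_i=x_i-P_i(U)=x_i-a_i+H_i(U)$ with $a_i\in\mathbb{K}$ and $H_i\in\mathbb{K}\{U\}$ homogeneous linear. For each $j$ there is an $i$ with $\mathrm{ord}(F_i,u_j)\ge0$. Differential resultant. Let $\mathbb{D}$ be a differential integral domain and $f_1,\dots,f_n\in\mathbb{D}\{U\}$ linear; $o_i$ is the order of $f_i$ in the variables $U$ (order $0$ if no $u_j$ occurs), $N=\sum_io_i$, $\gamma_j=\min_i\{o_i-\mathrm{ord}(f_i,u_j)\}$, $\gamma=\sum_{j=1}^{n-1}\gamma_j$, with the standing assumption $\gamma\le N-o_i$ for all $i$. The $L=\sum_i(N-o_i-\gamma+1)$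 polynomials $\partial^kf_i$, $1\le i\le n$, $0\le k\le N-o_i-\gamma$, involve the $L-1$ variables $\mathcal{V}=\{u_{jk}\mid 1\le j\le n-1,\ 0\le k\le N-\gamma_j-\gamma\}$. $M(L)$ is the $L\times L$ matrix whose rows list, for $i=1,\dots,n$ successively, the coefficients of $\partial^{N-o_i-\gamma}f_i,\dots,\partial f_i,f_i$ in the variables of $\mathcal{V}$ in decreasing order for the orderly ranking on $U$ with $u_1<\dots<u_{n-1}$ (derivatives of higher order are larger; equal orders are compared by index), the last column containing the terms free of $U$. Then $\partial\mathrm{CRes}(f_1,\dots,f_n)=\det M(L)$. Perturbation. $p$ is a differential indeterminate over $\mathbb{K}$ with $\partial(p)=0$. A linear perturbation is a family $\phi=(\phi_1(U),\dots,\phi_n(U))$ of linear differential polynomials in $\mathbb{K}\{U\}$; the perturbed system $\mathcal{P}_\phi(X,U)$ is $x_i=P_i(U)+p\,\phi_i(U)$, and $F_i^\phi=F_i-p\,\phi_i(U)$. The leading matrix $S^\phi$ of $\mathcal{P}_\phi$ is the $n\times(n-1)$ matrix whose $(i,j)$ entry is the coefficient of $u_{n-j,\,o_i-\gamma_{n-j}}$ in $F_i^\phi$ ($0$ if the index is negative), with $o_i,\gamma_j$ computed for $F_1^\phi,\dots,F_n^\phi$. $S_n^\phi$ is $S^\phi$ with its $n$-th row removed. *)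

theory Defs
  imports
    "HOL-Library.Poly_Mapping"
    "HOL-Library.Product_Lexorder"
    "HOL-Computational_Algebra.Polynomial"
    "Jordan_Normal_Form.Determinant"
begin

definition is_derivation :: "('a::comm_ring_1 \<Rightarrow> 'a) \<Rightarrow> bool" where
  "is_derivation d \<longleftrightarrow>
     (\<forall>a b. d (a + b) = d a + d b) \<and> (\<forall>a b. d (a * b) = d a * b + a * d b)"


section \<open>Differential polynomials\<close>

text \<open>
  A differential polynomial in the differential indeterminates \<open>y\<^sub>0, y\<^sub>1, \<dots>\<close> is a
  polynomial in the variables \<open>(j, k)\<close>, where \<open>(j, k)\<close> stands for the
  \<open>k\<close>-th derivative of \<open>y\<^sub>j\<close>. The ring with indeterminates restricted to an index
  set \<open>J\<close> is the subset \<open>dpolys J\<close>.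
  (The lexicographic order on pairs is imported only because the integral domain instance of
  \<open>poly_mapping\<close> needs some linear order on the variables; it is not a ranking.)
\<close>

type_synonym 'a dpoly = "((nat \<times> nat) \<Rightarrow>\<^sub>0 nat) \<Rightarrow>\<^sub>0 'a"

abbreviation coeff_mon :: "'a::zero dpoly \<Rightarrow> ((nat \<times> nat) \<Rightarrow>\<^sub>0 nat) \<Rightarrow> 'a" where
  "coeff_mon \<equiv> Poly_Mapping.lookup"

definition dconst :: "'a::zero \<Rightarrow> 'a dpoly" where
  "dconst c = Poly_Mapping.single 0 c"

definition dvar :: "nat \<Rightarrow> nat \<Rightarrow> 'a::zero_neq_one dpoly" where
  "dvar j k = Poly_Mapping.single (Poly_Mapping.single (j, k) 1) 1"

definition coeff_var :: "'a::zero dpoly \<Rightarrow> nat \<Rightarrow> nat \<Rightarrow> 'a" where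
  "coeff_var f j k = coeff_mon f (Poly_Mapping.single (j, k) 1)"

definition coeff_free :: "'a::zero dpoly \<Rightarrow> 'a" where
  "coeff_free f = coeff_mon f 0"

text \<open>
  \<open>map_coeffs h\<close> is only used for \<open>h\<close> with \<open>h 0 = 0\<close>.
\<close>

abbreviation map_coeffs :: "('a::zero \<Rightarrow> 'b::zero) \<Rightarrow> 'a dpoly \<Rightarrow> 'b dpoly" where
  "map_coeffs \<equiv> Poly_Mapping.map"

definition dvars :: "'a::zero dpoly \<Rightarrow> (nat \<times> nat) set" where
  "dvars f = (\<Union>m\<in>Poly_Mapping.keys f. Poly_Mapping.keys m)"

definition dpolys :: "nat set \<Rightarrow> 'a::zero dpoly set" where
  "dpolys J = {f. dvars f \<subseteq> J \<times> UNIV}"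

definition linear_dpoly :: "'a::zero dpoly \<Rightarrow> bool" where
  "linear_dpoly f \<longleftrightarrow>
     (\<forall>m\<in>Poly_Mapping.keys f. (\<Sum>v\<in>Poly_Mapping.keys m. Poly_Mapping.lookup m v) \<le> 1)"

text \<open>
  The extension of a derivation \<open>d\<close> of the coefficients sending \<open>(j, k)\<close> to \<open>(j, k + 1)\<close>;
  on a monomial \<open>m\<close> with coefficient \<open>c\<close> it is
  \<open>d c m + (\<Sum>v. c (\<partial>m/\<partial>v) v')\<close>.
\<close>

definition dderiv_term ::
  "('a \<Rightarrow> 'a) \<Rightarrow> ((nat \<times> nat) \<Rightarrow>\<^sub>0 nat) \<Rightarrow> 'a \<Rightarrow> 'a::comm_ring_1 dpoly" where
  "dderiv_term d m c =
     Poly_Mapping.single m (d c) +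
     (\<Sum>v\<in>Poly_Mapping.keys m.
        Poly_Mapping.single
          (m - Poly_Mapping.single v 1 + Poly_Mapping.single (fst v, Suc (snd v)) 1)
          (of_nat (Poly_Mapping.lookup m v) * c))"

definition dderiv :: "('a \<Rightarrow> 'a) \<Rightarrow> 'a dpoly \<Rightarrow> 'a::comm_ring_1 dpoly" where
  "dderiv d f = (\<Sum>m\<in>Poly_Mapping.keys f. dderiv_term d m (coeff_mon f m))"

definition dord :: "'a::zero dpoly \<Rightarrow> nat \<Rightarrow> int" where
  "dord f j = (if \<exists>k. (j, k) \<in> dvars f then int (Max {k. (j, k) \<in> dvars f}) else -1)"

lemma is_derivation_0:
  assumes "is_derivation d"
  shows "d 0 = 0"
proof -
  have "d (0 + 0) = d 0 + d 0"
    using assms unfolding is_derivation_def by blast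
  then show ?thesis by simp
qed

lemma is_derivation_map_poly:
  assumes "is_derivation d"
  shows "is_derivation (map_poly d)"
proof -
  have d0: "d 0 = 0" by (rule is_derivation_0[OF assms])
  have dadd: "d (a + b) = d a + d b" and dmul: "d (a * b) = d a * b + a * d b" for a b
    using assms unfolding is_derivation_def by blast+
  have dsum: "d (sum g A) = (\<Sum>x\<in>A. d (g x))" for g :: "nat \<Rightarrow> 'a" and A
    by (induction A rule: infinite_finite_induct) (simp_all add: d0 dadd)
  show ?thesis
    unfolding is_derivation_def
    by (auto intro!: poly_eqI simp: coeff_map_poly d0 dadd dmul coeff_mult dsum sum.distrib)
qed

lemma dderiv_dconst:
  assumes "is_derivation d"
  shows "dderiv d (dconst c) = dconst (d c)"
  using is_derivation_0[OF assms]
  by (cases "c = 0") (simp_all add: dderiv_def dconst_def dderiv_term_def)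

lemma dderiv_dvar:
  assumes "is_derivation d"
  shows "dderiv d (dvar j k) = dvar j (Suc k)"
proof -
  have "d (1 * 1) = d 1 * 1 + 1 * d 1"
    using assms unfolding is_derivation_def by blast
  then have "d 1 = 0" by simp
  then show ?thesis
    by (simp add: dderiv_def dvar_def dderiv_term_def)
qed

lemma is_derivation_dderiv:
  assumes "is_derivation d"
  shows "is_derivation (dderiv d)"
proof -
  let ?T = "dderiv_term d"
  have d0: "d 0 = 0" by (rule is_derivation_0[OF assms])
  have dadd: "d (a + b) = d a + d b" and dmul: "d (a * b) = d a * b + a * d b" for a b
    using assms unfolding is_derivation_def by blast+
  have T0: "?T m 0 = 0" for m by (simp add: dderiv_term_def d0)
  have Tadd: "?T m (a + b) = ?T m a + ?T m b" for m a b
    by (simp add: dderiv_term_def dadd single_add distrib_left sum.distrib algebra_simps)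
  have super: "dderiv d f = (\<Sum>m\<in>S. ?T m (coeff_mon f m))"
    if "finite S" "Poly_Mapping.keys f \<subseteq> S" for f S
    unfolding dderiv_def
    by (rule sum.mono_neutral_left) (use that T0 in \<open>auto simp: in_keys_iff\<close>)
  have add: "dderiv d (f + g) = dderiv d f + dderiv d g" for f g
  proof -
    let ?S = "Poly_Mapping.keys f \<union> Poly_Mapping.keys g"
    have "Poly_Mapping.keys (f + g) \<subseteq> ?S" by (rule keys_add)
    then show ?thesis
      by (simp add: super[of ?S] lookup_add Tadd sum.distrib)
  qed
  have dd0: "dderiv d 0 = 0" by (simp add: dderiv_def)
  have single: "dderiv d (Poly_Mapping.single m c) = ?T m c" for m c
    by (simp add: super[of "{m}"])
  let ?e = "\<lambda>v. Poly_Mapping.single v (1::nat)"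
  let ?e' = "\<lambda>v. Poly_Mapping.single (fst v, Suc (snd v)) (1::nat)"
  have Tsup: "?T m c = Poly_Mapping.single m (d c) +
      (\<Sum>v\<in>S. Poly_Mapping.single (m - ?e v + ?e' v) (of_nat (Poly_Mapping.lookup m v) * c))"
    if "finite S" "Poly_Mapping.keys m \<subseteq> S" for m c S
  proof -
    have "(\<Sum>v\<in>Poly_Mapping.keys m. Poly_Mapping.single (m - ?e v + ?e' v)
             (of_nat (Poly_Mapping.lookup m v) * c))
        = (\<Sum>v\<in>S. Poly_Mapping.single (m - ?e v + ?e' v) (of_nat (Poly_Mapping.lookup m v) * c))"
      by (rule sum.mono_neutral_left) (use that in \<open>auto simp: in_keys_iff\<close>)
    then show ?thesis by (simp add: dderiv_term_def)
  qed
  have shift: "Poly_Mapping.single (m + n - ?e v + ?e' v) (of_nat (Poly_Mapping.lookup m v) * c)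
      = Poly_Mapping.single ((m - ?e v + ?e' v) + n) (of_nat (Poly_Mapping.lookup m v) * c)"
    for m n v c
  proof (cases "Poly_Mapping.lookup m v = 0")
    case False
    have "m + n - ?e v + ?e' v = (m - ?e v + ?e' v) + n"
      by (rule poly_mapping_eqI)
         (use False in \<open>auto simp: lookup_add lookup_minus lookup_single when_def\<close>)
    then show ?thesis by simp
  qed simp
  have Tmul: "?T (m + n) (a * b) = ?T m a * Poly_Mapping.single n b
      + Poly_Mapping.single m a * ?T n b" for m n a b
  proof -
    let ?S = "Poly_Mapping.keys m \<union> Poly_Mapping.keys n"
    let ?f = "\<lambda>m n v a b. Poly_Mapping.single (m + n - ?e v + ?e' v)
               (of_nat (Poly_Mapping.lookup m v) * (a * b))"
    have k: "Poly_Mapping.keys (m + n) \<subseteq> ?S" by (rule keys_add)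
    have L: "?T (m + n) (a * b) = Poly_Mapping.single (m + n) (d a * b)
        + Poly_Mapping.single (m + n) (a * d b)
        + ((\<Sum>v\<in>?S. ?f m n v a b) + (\<Sum>v\<in>?S. ?f n m v b a))"
      by (simp add: Tsup[OF _ k] dmul single_add lookup_add distrib_right distrib_left
          sum.distrib mult.commute[of b a] add.commute[of n m] add_ac del: One_nat_def)
    have A: "?T m' a' * Poly_Mapping.single n' b'
        = Poly_Mapping.single (m' + n') (d a' * b') + (\<Sum>v\<in>?S. ?f m' n' v a' b')"
      if "Poly_Mapping.keys m' \<subseteq> ?S" for m' n' :: "(nat \<times> nat) \<Rightarrow>\<^sub>0 nat" and a' b'
      by (subst Tsup[of ?S, OF _ that])
        (simp_all add: distrib_right sum_distrib_right mult_single shift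
          mult.assoc del: One_nat_def)
    have "Poly_Mapping.single m a * ?T n b
        = Poly_Mapping.single (m + n) (a * d b) + (\<Sum>v\<in>?S. ?f n m v b a)"
      unfolding mult.commute[of "Poly_Mapping.single m a"] mult.commute[of a "d b"]
        add.commute[of m n]
      by (rule A) simp
    then show ?thesis
      unfolding L A[of m a n b, OF Un_upper1] by (simp only: add_ac)
  qed
  have decomp: "f = (\<Sum>m\<in>Poly_Mapping.keys f. Poly_Mapping.single m (coeff_mon f m))"
    for f :: "'a dpoly"
    by (rule poly_mapping_eqI) (auto simp: lookup_sum lookup_single when_def in_keys_iff)
  have dsum: "dderiv d (sum g A) = (\<Sum>x\<in>A. dderiv d (g x))"
    for g :: "((nat \<times> nat) \<Rightarrow>\<^sub>0 nat) \<Rightarrow> 'a dpoly" and A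
    by (induction A rule: infinite_finite_induct) (simp_all add: dd0 add)
  have mul1: "dderiv d (Poly_Mapping.single m a * g)
      = dderiv d (Poly_Mapping.single m a) * g + Poly_Mapping.single m a * dderiv d g" for m a g
    by (subst (1 2 3) decomp[of g])
       (simp add: sum_distrib_left dsum mult_single single Tmul sum.distrib)
  have mul: "dderiv d (f * g) = dderiv d f * g + f * dderiv d g" for f g
    by (subst (1 2 3) decomp[of f])
       (simp add: sum_distrib_right dsum mul1 sum.distrib)
  show ?thesis unfolding is_derivation_def using add mul by blast
qed


section \<open>The linear differential resultant\<close>

text \<open>
  Throughout, \<open>f\<close> is a family \<open>f\<^sub>1, \<dots>, f\<^sub>n\<close> in \<open>u\<^sub>1, \<dots>, u\<^bsub>n-1\<^esub>\<close>, both indexed from 1.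
\<close>

definition lead_ord :: "nat \<Rightarrow> 'a::zero dpoly \<Rightarrow> int" where
  "lead_ord n f = Max (insert 0 (dord f ` {1..n - 1}))"

definition ord_sum :: "nat \<Rightarrow> (nat \<Rightarrow> 'a::zero dpoly) \<Rightarrow> int" where
  "ord_sum n f = (\<Sum>i = 1..n. lead_ord n (f i))"

definition gam :: "nat \<Rightarrow> (nat \<Rightarrow> 'a::zero dpoly) \<Rightarrow> nat \<Rightarrow> int" where
  "gam n f j = Min ((\<lambda>i. lead_ord n (f i) - dord (f i) j) ` {1..n})"

definition gam_sum :: "nat \<Rightarrow> (nat \<Rightarrow> 'a::zero dpoly) \<Rightarrow> int" where
  "gam_sum n f = (\<Sum>j = 1..n - 1. gam n f j)"

definition dcres_defined :: "nat \<Rightarrow> (nat \<Rightarrow> 'a::zero dpoly) \<Rightarrow> bool" where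
  "dcres_defined n f \<longleftrightarrow>
     (\<forall>i\<in>{1..n}. f i \<in> dpolys {1..n - 1} \<and> linear_dpoly (f i) \<and>
        gam_sum n f \<le> ord_sum n f - lead_ord n (f i))"

definition dcres_dim :: "nat \<Rightarrow> (nat \<Rightarrow> 'a::zero dpoly) \<Rightarrow> nat" where
  "dcres_dim n f = nat (\<Sum>i = 1..n. ord_sum n f - lead_ord n (f i) - gam_sum n f + 1)"

definition dcres_rows ::
  "('a \<Rightarrow> 'a) \<Rightarrow> nat \<Rightarrow> (nat \<Rightarrow> 'a::comm_ring_1 dpoly) \<Rightarrow> 'a dpoly list" where
  "dcres_rows d n f =
     [(dderiv d ^^ k) (f i).
        i \<leftarrow> [1..<Suc n],
        k \<leftarrow> rev [0..<nat (ord_sum n f - lead_ord n (f i) - gam_sum n f + 1)]]"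

text \<open>
  The variables \<open>(j, k)\<close> with \<open>1 \<le> j \<le> n - 1\<close> and \<open>0 \<le> k \<le> N - \<gamma>\<^sub>j - \<gamma>\<close>, in decreasing
  order for the orderly ranking with \<open>u\<^sub>1 < \<dots> < u\<^bsub>n-1\<^esub>\<close>. Since \<open>\<gamma>\<^sub>j \<ge> 0\<close>, letting
  \<open>k\<close> run up to \<open>N - \<gamma>\<close> before filtering loses nothing.
\<close>

definition dcres_cols :: "nat \<Rightarrow> (nat \<Rightarrow> 'a::zero dpoly) \<Rightarrow> (nat \<times> nat) list" where
  "dcres_cols n f =
     [(j, k).
        k \<leftarrow> rev [0..<nat (ord_sum n f - gam_sum n f + 1)],
        j \<leftarrow> rev [1..<n],
        int k \<le> ord_sum n f - gam n f j - gam_sum n f]"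

definition dcres_mat ::
  "('a \<Rightarrow> 'a) \<Rightarrow> nat \<Rightarrow> (nat \<Rightarrow> 'a::idom dpoly) \<Rightarrow> 'a mat" where
  "dcres_mat d n f =
     (let L = dcres_dim n f; rows = dcres_rows d n f; cols = dcres_cols n f
      in mat L L (\<lambda>(r, c).
           if c < L - 1 then coeff_var (rows ! r) (fst (cols ! c)) (snd (cols ! c))
           else coeff_free (rows ! r)))"

definition dcres :: "('a \<Rightarrow> 'a) \<Rightarrow> nat \<Rightarrow> (nat \<Rightarrow> 'a::idom dpoly) \<Rightarrow> 'a" where
  "dcres d n f = det (dcres_mat d n f)"

text \<open>
  \<open>mat\<close> counts rows and columns from 0, whence the shifts by one.
\<close>

definition leading_mat :: "nat \<Rightarrow> (nat \<Rightarrow> 'a::zero dpoly) \<Rightarrow> 'a mat" where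
  "leading_mat n f =
     mat n (n - 1) (\<lambda>(r, c).
       let i = r + 1; j = c + 1; k = lead_ord n (f i) - gam n f (n - j)
       in if k < 0 then 0 else coeff_var (f i) (n - j) (nat k))"

definition leading_mat_del_last :: "nat \<Rightarrow> (nat \<Rightarrow> 'a::zero dpoly) \<Rightarrow> 'a mat" where
  "leading_mat_del_last n f = mat (n - 1) (n - 1) (\<lambda>(r, c). leading_mat n f $$ (r, c))"

lemma gam_nonneg:
  assumes "j \<in> {1..n - 1}" "n \<ge> 2"
  shows "gam n f j \<ge> 0"
proof -
  have "dord (f i) j \<le> lead_ord n (f i)" for i
    unfolding lead_ord_def using assms by (intro Max_ge) auto
  then show ?thesis
    using assms(2) unfolding gam_def by (subst Min_ge_iff) auto
qed

lemma length_dcres_rows: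
  assumes "dcres_defined n f"
  shows "length (dcres_rows d n f) = dcres_dim n f"
proof -
  have "int (length (dcres_rows d n f))
      = (\<Sum>i = 1..n. ord_sum n f - lead_ord n (f i) - gam_sum n f + 1)"
    using assms
    by (simp add: dcres_rows_def length_concat comp_def interv_sum_list_conv_sum_set_nat
        atLeastLessThanSuc_atLeastAtMost dcres_defined_def del: upt_Suc)
  then show ?thesis unfolding dcres_dim_def by linarith
qed

lemma set_dcres_cols:
  assumes "n \<ge> 2"
  shows "set (dcres_cols n f) =
    {(j, k). j \<in> {1..n - 1} \<and> int k \<le> ord_sum n f - gam n f j - gam_sum n f}"
proof -
  have "k < nat (ord_sum n f - gam_sum n f + 1)"
    if "j \<in> {1..n - 1}" "int k \<le> ord_sum n f - gam n f j - gam_sum n f" for j k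
    using gam_nonneg[OF that(1) assms, of f] that(2) by linarith
  then show ?thesis
    using assms by (fastforce simp: dcres_cols_def)
qed

lemma length_dcres_cols:
  assumes "dcres_defined n f" "n \<ge> 2"
  shows "Suc (length (dcres_cols n f)) = dcres_dim n f"
proof -
  let ?N = "ord_sum n f" and ?g = "gam_sum n f"
  let ?K = "nat (?N - ?g + 1)" and ?c = "\<lambda>j. ?N - gam n f j - ?g"
  have le: "gam n f j \<le> ?N - ?g + 1" if "j \<in> {1..n - 1}" for j
  proof -
    have "gam n f j \<le> lead_ord n (f 1) - dord (f 1) j"
      using assms(2) unfolding gam_def by (intro Min_le) auto
    also have "\<dots> \<le> lead_ord n (f 1) + 1" by (simp add: dord_def)
    finally show ?thesis using assms unfolding dcres_defined_def by force
  qed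
  have "length (dcres_cols n f) = (\<Sum>k<?K. \<Sum>j\<in>{1..n - 1}. if int k \<le> ?c j then 1 else 0)"
  proof -
    have "{1..<n} = {1..n - 1}" using assms(2) by auto
    moreover have "sum_list (map h (rev [a..<b])) = sum h {a..<b}" for h :: "nat \<Rightarrow> nat" and a b
      by (simp add: rev_map[symmetric] interv_sum_list_conv_sum_set_nat)
    ultimately show ?thesis
      by (simp add: dcres_cols_def length_concat comp_def if_distrib[of length]
          atLeast0LessThan cong: if_cong)
  qed
  also have "\<dots> = (\<Sum>j\<in>{1..n - 1}. \<Sum>k<?K. if int k \<le> ?c j then 1 else 0)"
    by (rule sum.swap)
  also have "\<dots> = (\<Sum>j\<in>{1..n - 1}. nat (?c j + 1))"
  proof (rule sum.cong)
    fix j assume j: "j \<in> {1..n - 1}"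
    have "{k \<in> {..<?K}. int k \<le> ?c j} = {..<nat (?c j + 1)}"
      using gam_nonneg[OF j assms(2), of f] by auto
    moreover have "(\<Sum>k<?K. if int k \<le> ?c j then 1 else 0) = card {k \<in> {..<?K}. int k \<le> ?c j}"
      by (simp add: sum.If_cases Int_def)
    ultimately show "(\<Sum>k<?K. if int k \<le> ?c j then 1 else 0) = nat (?c j + 1)" by simp
  qed simp
  finally have "int (length (dcres_cols n f)) = (\<Sum>j\<in>{1..n - 1}. int (nat (?c j + 1)))"
    by simp
  also have "\<dots> = (\<Sum>j\<in>{1..n - 1}. ?N - ?g + 1 - gam n f j)"
    by (rule sum.cong) (use le in force)+
  also have "\<dots> = int (n - 1) * (?N - ?g + 1) - ?g"
    by (simp add: sum_subtractf gam_sum_def)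
  finally have len: "int (length (dcres_cols n f)) = int (n - 1) * (?N - ?g + 1) - ?g" .
  have "(\<Sum>i = 1..n. ?N - lead_ord n (f i) - ?g + 1) = (\<Sum>i = 1..n. (?N - ?g + 1) - lead_ord n (f i))"
    by (rule sum.cong) auto
  also have "\<dots> = int n * (?N - ?g + 1) - ?N"
    by (simp add: sum_subtractf ord_sum_def)
  also have "\<dots> = int (length (dcres_cols n f)) + 1"
    using assms(2) by (simp add: len of_nat_diff algebra_simps)
  finally show ?thesis unfolding dcres_dim_def by simp
qed


section \<open>Linear systems of differential polynomial parametric equations\<close>

text \<open>
  The differential ring \<open>\<K>[p]\<close> with \<open>\<partial>p = 0\<close> is \<open>'k poly\<close> with the derivation \<open>map_poly d\<close>,
  \<open>\<K>[p]{X}\<close> is \<open>'k poly dpoly\<close>, and \<open>\<K>[p]{X}{U}\<close> is \<open>'k poly dpoly dpoly\<close>.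
\<close>

definition linear_dppe :: "nat \<Rightarrow> (nat \<Rightarrow> 'k::field dpoly) \<Rightarrow> bool" where
  "linear_dppe n P \<longleftrightarrow>
     (\<forall>i\<in>{1..n}. P i \<in> dpolys {1..n - 1} \<and> linear_dpoly (P i)) \<and>
     (\<exists>i\<in>{1..n}. P i \<notin> Set.range dconst)"

definition sys_poly :: "(nat \<Rightarrow> 'k::field dpoly) \<Rightarrow> nat \<Rightarrow> 'k dpoly dpoly" where
  "sys_poly P i = dconst (dvar i 0) - map_coeffs dconst (P i)"

definition linear_perturbation :: "nat \<Rightarrow> (nat \<Rightarrow> 'k::field dpoly) \<Rightarrow> bool" where
  "linear_perturbation n \<phi> \<longleftrightarrow> (\<forall>i\<in>{1..n}. \<phi> i \<in> dpolys {1..n - 1} \<and> linear_dpoly (\<phi> i))"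

text \<open>
  \<open>F\<^sub>i - p \<phi>\<^sub>i(U)\<close>, after embedding \<open>F\<^sub>i\<close> and \<open>\<phi>\<^sub>i\<close> into \<open>\<K>[p]{X}{U}\<close>.
\<close>

definition perturbed_poly ::
  "(nat \<Rightarrow> 'k::field dpoly) \<Rightarrow> (nat \<Rightarrow> 'k dpoly) \<Rightarrow> nat \<Rightarrow> 'k poly dpoly dpoly" where
  "perturbed_poly P \<phi> i =
     map_coeffs (map_coeffs (\<lambda>a. [:a:])) (sys_poly P i) -
     dconst (dconst [:0, 1:]) * map_coeffs (\<lambda>a. dconst [:a:]) (\<phi> i)"

end

theory Submission
  imports Defs
begin

text \<open>
  Let \<open>D > 0\<close> exceed every order occurring in \<open>P\<close>, and perturb by
  \<open>\<phi>\<^sub>1 = u\<^bsub>n-1\<^esub>\<^bsup>(D)\<^esup>\<close>, \<open>\<phi>\<^sub>i = u\<^bsub>n-i\<^esub>\<^bsup>(D)\<^esup> + u\<^bsub>n-i+1\<^esub>\<close> for \<open>1 < i < n\<close>, and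
  \<open>\<phi>\<^sub>n = u\<^sub>1\<^bsup>(D)\<^esup> + u\<^sub>1\<close>. The perturbation alone then decides all orders: every perturbed
  polynomial has order \<open>D\<close>, and each \<open>u\<^sub>j\<close> attains that order in the polynomial number \<open>n - j\<close>.
  Hence \<open>\<gamma>\<^sub>j = 0\<close> for all \<open>j\<close>, \<open>N = n D\<close>, and the leading matrix without its last row is
  \<open>- p\<close> times the identity (\<open>det_leading_mat_F\<close>).

  For the resultant put \<open>K = (n - 1) D\<close>; the rows are \<open>\<partial>\<^sup>k F\<^sub>i\<close> with \<open>k \<le> K\<close>. Only the last column
  of the matrix involves \<open>X\<close>, the variable \<open>x\<^bsub>n,K\<^esub>\<close> occurs in it exactly once, namely in the row of
  \<open>\<partial>\<^sup>K F\<^sub>n\<close>, and all entries of the other \<open>L - 1\<close> columns have degree at most 1 in \<open>p\<close>.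
  Therefore the coefficient of \<open>x\<^bsub>n,K\<^esub> p\<^bsup>L-1\<^esup>\<close> in the resultant is a determinant over \<open>\<K>\<close> that
  depends only on \<open>\<phi>\<close>: its rows are the coefficient vectors of \<open>- \<partial>\<^sup>k \<phi>\<^sub>i\<close>, completed by a
  unit vector in the last column (\<open>coeff_det_const_columns\<close>).

  To see that this determinant is nonzero, take a linear relation between its rows. Since the
  coefficients of \<open>\<phi>\<close> are constants, deriving \<open>\<phi>\<^sub>i\<close> is a shift, so that the relation is a
  family of polynomials \<open>c\<^sub>1, \<dots>, c\<^sub>n\<close> in \<open>t\<close> of degree at most \<open>K\<close> with
  \[ t^D c_i + c_{i+1} = 0 \quad (1 \le i < n-1), \qquad t^D c_{n-1} + (1 + t^D) c_n = 0, \]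
  and the last column says that the coefficient of \<open>t\<^sup>K\<close> in \<open>c\<^sub>n\<close> is 0. The first relations make
  \<open>c\<^bsub>n-1\<^esub>\<close> a multiple of \<open>t\<^bsup>K-D\<^esup>\<close>, so the last one makes \<open>(1 + t\<^sup>D) c\<^sub>n\<close>, and then \<open>c\<^sub>n\<close>
  itself, a multiple of \<open>t\<^sup>K\<close>. As its degree is less than \<open>K\<close>, \<open>c\<^sub>n = 0\<close>, and going
  backwards all \<open>c\<^sub>i\<close> vanish (\<open>vanishing_of_chain_syzygy\<close>).
\<close>


section \<open>Coefficients of differential polynomials\<close>

lemma lookup_dconst_mult: "Poly_Mapping.lookup (dconst c * f) m = c * Poly_Mapping.lookup f m"
  for c :: "'a::comm_ring_1"
proof -
  have "dconst c * f = Poly_Mapping.map ((*) c) f"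
    by (simp add: dconst_def mult_map_scale_conv_mult)
  then show ?thesis by (simp add: map.rep_eq when_def)
qed

lemma dconst_0 [simp]: "dconst 0 = 0"
  by (simp add: dconst_def)

lemma dconst_add: "dconst (a + b) = dconst a + dconst (b :: 'a::comm_ring_1)"
  by (simp add: dconst_def single_add)

lemma dconst_mult: "dconst (a * b) = dconst a * dconst (b :: 'a::comm_ring_1)"
  by (simp add: dconst_def mult_single)

lemma coeff_mon_map_coeffs:
  "h 0 = 0 \<Longrightarrow> coeff_mon (map_coeffs h f) m = h (coeff_mon f m)"
  by (simp add: map.rep_eq when_def)

lemma single_eq_zero_iff: "Poly_Mapping.single v a = 0 \<longleftrightarrow> a = 0"
  by (metis lookup_single_eq lookup_zero single_zero)

lemma unit_monomial_eq_iff: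
  "Poly_Mapping.single v (1::nat) = Poly_Mapping.single w 1 \<longleftrightarrow> v = w"
  by (metis lookup_single_eq lookup_single_not_eq zero_neq_one)

text \<open>
  Deriving one variable of a monomial keeps its total degree, so only a variable can be turned
  into a variable.
\<close>

lemma monomial_shift_eq_unit_iff:
  assumes v: "v \<in> Poly_Mapping.keys m"
  shows "m - Poly_Mapping.single v 1 + Poly_Mapping.single (fst v, Suc (snd v)) 1
           = Poly_Mapping.single (j, l) (1::nat)
         \<longleftrightarrow> l \<noteq> 0 \<and> v = (j, l - 1) \<and> m = Poly_Mapping.single (j, l - 1) 1"
    (is "?L \<longleftrightarrow> ?R")
proof
  assume L: ?L
  let ?v' = "(fst v, Suc (snd v))"
  have at: "Poly_Mapping.lookup m x - (1 when v = x) + (1 when ?v' = x) = (1 when (j, l) = x)"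
    for x using arg_cong[OF L, of "\<lambda>q. Poly_Mapping.lookup q x"]
    by (simp add: lookup_add lookup_minus lookup_single)
  have v': "?v' = (j, l)"
    using at[of ?v'] by (auto simp: when_def split: if_splits)
  have "m = Poly_Mapping.single v 1"
  proof (rule poly_mapping_eqI)
    fix x
    have "Poly_Mapping.lookup m v \<noteq> 0" using v by (simp add: in_keys_iff)
    then show "Poly_Mapping.lookup m x = Poly_Mapping.lookup (Poly_Mapping.single v 1) x"
      using at[of x] v' by (auto simp: lookup_single when_def split: if_splits)
  qed
  moreover have "l \<noteq> 0" "v = (j, l - 1)" using v' by (auto simp: prod_eq_iff)
  ultimately show ?R by blast
qed (auto simp: One_nat_def[symmetric] simp del: One_nat_def)

lemma coeff_var_dderiv:
  assumes "d 0 = (0::'a::comm_ring_1)"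
  shows "coeff_var (dderiv d f) j l
           = d (coeff_var f j l) + (if l = 0 then 0 else coeff_var f j (l - 1))"
proof -
  let ?e = "\<lambda>l. Poly_Mapping.single (j, l) (1::nat)"
  have "coeff_mon (dderiv_term d m c) (?e l)
      = (d c when m = ?e l) + (c when l \<noteq> 0 \<and> m = ?e (l - 1))" for m c
  proof -
    have "coeff_mon (dderiv_term d m c) (?e l) = (d c when m = ?e l)
        + (\<Sum>v\<in>Poly_Mapping.keys m. of_nat (Poly_Mapping.lookup m v) * c
             when l \<noteq> 0 \<and> v = (j, l - 1) \<and> m = ?e (l - 1))"
      unfolding dderiv_term_def lookup_add lookup_sum lookup_single
      by (intro arg_cong2[of _ _ _ _ plus] refl sum.cong)
         (simp_all add: monomial_shift_eq_unit_iff del: One_nat_def)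
    also have "(\<Sum>v\<in>Poly_Mapping.keys m. of_nat (Poly_Mapping.lookup m v) * c
             when l \<noteq> 0 \<and> v = (j, l - 1) \<and> m = ?e (l - 1))
        = (c when l \<noteq> 0 \<and> m = ?e (l - 1))"
      by (cases "l \<noteq> 0 \<and> m = ?e (l - 1)") (auto simp: when_def)
    finally show ?thesis .
  qed
  then have "coeff_var (dderiv d f) j l
      = (\<Sum>m\<in>Poly_Mapping.keys f. d (coeff_mon f m) when m = ?e l)
      + (\<Sum>m\<in>Poly_Mapping.keys f. coeff_mon f m when l \<noteq> 0 \<and> m = ?e (l - 1))"
    by (simp add: coeff_var_def dderiv_def lookup_sum sum.distrib)
  also have "(\<Sum>m\<in>Poly_Mapping.keys f. d (coeff_mon f m) when m = ?e l) = d (coeff_var f j l)"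
    using assms by (auto simp: when_def coeff_var_def in_keys_iff)
  also have "(\<Sum>m\<in>Poly_Mapping.keys f. coeff_mon f m when l \<noteq> 0 \<and> m = ?e (l - 1))
      = (if l = 0 then 0 else coeff_var f j (l - 1))"
    by (auto simp: when_def coeff_var_def in_keys_iff)
  finally show ?thesis .
qed

lemma coeff_free_dderiv:
  assumes "d 0 = (0::'a::comm_ring_1)"
  shows "coeff_free (dderiv d f) = d (coeff_free f)"
proof -
  have "coeff_mon (dderiv_term d m c) 0 = (d c when m = 0)" for m c
  proof -
    have "m - Poly_Mapping.single v 1 + Poly_Mapping.single (fst v, Suc (snd v)) 1 \<noteq> (0 :: _ \<Rightarrow>\<^sub>0 nat)"
      for v :: "nat \<times> nat"
    proof
      assume "m - Poly_Mapping.single v 1 + Poly_Mapping.single (fst v, Suc (snd v)) 1 = 0"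
      from arg_cong[OF this, of "\<lambda>q. Poly_Mapping.lookup q (fst v, Suc (snd v))"]
      show False by (simp add: lookup_add)
    qed
    then show ?thesis
      by (simp add: dderiv_term_def lookup_add lookup_sum lookup_single del: One_nat_def)
  qed
  then show ?thesis
    using assms by (auto simp: coeff_free_def dderiv_def lookup_sum when_def in_keys_iff)
qed


section \<open>The ring of differential polynomials in given indeterminates\<close>

lemma dpolys_add: "f \<in> dpolys J \<Longrightarrow> g \<in> dpolys J \<Longrightarrow> f + g \<in> dpolys J"
  for f g :: "'a::comm_ring_1 dpoly"
  using keys_add[of f g] by (fastforce simp: dpolys_def dvars_def)

lemma dpolys_uminus: "f \<in> dpolys J \<Longrightarrow> - f \<in> dpolys J"
  for f :: "'a::comm_ring_1 dpoly"
  by (simp add: dpolys_def dvars_def)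

lemma dpolys_mult:
  fixes f g :: "'a::comm_ring_1 dpoly"
  assumes "f \<in> dpolys J" "g \<in> dpolys J"
  shows "f * g \<in> dpolys J"
proof -
  have "dvars (f * g) \<subseteq> dvars f \<union> dvars g"
  proof
    fix v assume "v \<in> dvars (f * g)"
    then obtain a b where ab: "a \<in> Poly_Mapping.keys f" "b \<in> Poly_Mapping.keys g"
        "v \<in> Poly_Mapping.keys (a + b)"
      using keys_mult[of f g] unfolding dvars_def by blast
    then show "v \<in> dvars f \<union> dvars g"
      using keys_add[of a b] unfolding dvars_def by blast
  qed
  then show ?thesis using assms by (auto simp: dpolys_def)
qed

lemma dpolys_dconst: "dconst c \<in> dpolys J"
  by (simp add: dpolys_def dvars_def dconst_def)

lemma dpolys_dvar: "j \<in> J \<Longrightarrow> dvar j k \<in> dpolys J"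
  by (simp add: dpolys_def dvars_def dvar_def)

lemma det_in_dpolys:
  fixes A :: "'a::comm_ring_1 dpoly mat"
  assumes A: "A \<in> carrier_mat m m"
    and entries: "\<And>r c. r < m \<Longrightarrow> c < m \<Longrightarrow> A $$ (r, c) \<in> dpolys J"
  shows "det A \<in> dpolys J"
proof -
  have zero: "0 \<in> dpolys J" and one: "1 \<in> dpolys J"
    by (simp_all add: dpolys_def dvars_def)
  have sums: "sum h S \<in> dpolys J" if "\<And>x. x \<in> S \<Longrightarrow> h x \<in> dpolys J"
    for h :: "(nat \<Rightarrow> nat) \<Rightarrow> 'a dpoly" and S
    using that by (induction S rule: infinite_finite_induct) (simp_all add: zero dpolys_add)
  have prods: "prod h S \<in> dpolys J" if "\<And>x. x \<in> S \<Longrightarrow> h x \<in> dpolys J"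
    for h :: "nat \<Rightarrow> 'a dpoly" and S
    using that by (induction S rule: infinite_finite_induct) (simp_all add: one dpolys_mult)
  have "signof p * x \<in> dpolys J" if "x \<in> dpolys J" for p :: "nat \<Rightarrow> nat" and x :: "'a dpoly"
    using that by (cases p rule: sign_cases) (simp_all add: dpolys_uminus)
  moreover have "(\<Prod>j<m. A $$ (p j, j)) \<in> dpolys J" if "p permutes {0..<m}" for p
    using permutes_in_image[OF that] by (intro prods entries) auto
  ultimately show ?thesis
    unfolding det_col[OF A] by (intro sums) auto
qed


section \<open>Top coefficients of determinants\<close>

text \<open>
  The two claims are stated together because the bound on the degree of the smaller product is
  needed to extract the top coefficient of the larger one.
\<close>

lemma coeff_prod_at_degree_bound:
  fixes h :: "'i \<Rightarrow> 'a::comm_ring_1 poly"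
  assumes "finite S" "\<And>i. i \<in> S \<Longrightarrow> degree (h i) \<le> 1"
  shows "degree (prod h S) \<le> card S \<and> coeff (prod h S) (card S) = (\<Prod>i\<in>S. coeff (h i) 1)"
  using assms
proof (induction S rule: finite_induct)
  case (insert i S)
  then have IH: "degree (prod h S) \<le> card S" "coeff (prod h S) (card S) = (\<Prod>i\<in>S. coeff (h i) 1)"
    and hi: "degree (h i) \<le> 1" by auto
  have *: "degree (h i * prod h S) \<le> Suc (card S)"
    using degree_mult_le[of "h i" "prod h S"] IH(1) hi by linarith
  have "coeff (h i * prod h S) (1 + card S) = coeff (h i) 1 * coeff (prod h S) (card S)"
  proof -
    have "coeff (h i) k * coeff (prod h S) (1 + card S - k) =
          (if k = 1 then coeff (h i) 1 * coeff (prod h S) (card S) else 0)" for k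
    proof -
      consider "k = 0" | "k = 1" | "k > 1" by linarith
      then show ?thesis
        using IH(1) hi by cases (auto simp: coeff_eq_0)
    qed
    then show ?thesis by (simp add: coeff_mult)
  qed
  then show ?case using insert * IH by simp
qed simp

text \<open>
  Every term of the expansion takes exactly one factor from each column. If all columns but
  the last are free of differential indeterminates and of degree at most 1 in \<open>p\<close>, then the
  monomial \<open>e\<close> has to come from the last column, and the power \<open>p\<^sup>m\<close> has to come from choosing the
  coefficient of \<open>p\<close> in all the \<open>m\<close> others.
\<close>

lemma coeff_det_const_columns:
  fixes a :: "nat \<Rightarrow> nat \<Rightarrow> 'a::comm_ring_1 poly" and b :: "nat \<Rightarrow> 'a poly dpoly"
  assumes deg_a: "\<And>r c. r \<le> m \<Longrightarrow> c < m \<Longrightarrow> degree (a r c) \<le> 1"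
    and deg_b: "\<And>r. r \<le> m \<Longrightarrow> degree (coeff_mon (b r) e) = 0"
  shows "coeff (coeff_mon (det (mat (Suc m) (Suc m)
             (\<lambda>(r, c). if c < m then dconst (a r c) else b r))) e) m
       = det (mat (Suc m) (Suc m)
             (\<lambda>(r, c). if c < m then coeff (a r c) 1 else coeff (coeff_mon (b r) e) 0))"
    (is "coeff (coeff_mon (det ?A) e) m = det ?B")
proof -
  define H where "H f = coeff (coeff_mon f e) m" for f :: "'a poly dpoly"
  have H_sum: "H (sum g S) = (\<Sum>x\<in>S. H (g x))" for g :: "(nat \<Rightarrow> nat) \<Rightarrow> _" and S
    by (simp add: H_def lookup_sum coeff_sum)
  have H_sign: "H (signof p * f) = signof p * H f" for p :: "nat \<Rightarrow> nat" and f
    by (cases p rule: sign_cases) (simp_all add: H_def)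
  have prod_dconst: "(\<Prod>c<k. dconst (g c)) = dconst (\<Prod>c<k. g c)"
    for g :: "nat \<Rightarrow> 'a poly" and k
    by (induction k) (simp_all add: dconst_mult, simp add: dconst_def)
  have H_prod: "H (\<Prod>c<Suc m. ?A $$ (p c, c)) = (\<Prod>c<Suc m. ?B $$ (p c, c))"
    if p: "p permutes {0..<Suc m}" for p
  proof -
    have le: "p c \<le> m" if "c \<le> m" for c
      using permutes_in_image[OF p, of c] that by auto
    have "(\<Prod>c<Suc m. ?A $$ (p c, c)) = dconst (\<Prod>c<m. a (p c) c) * b (p m)"
      using le by (simp add: less_Suc_eq_le prod_dconst)
    then have "H (\<Prod>c<Suc m. ?A $$ (p c, c))
        = coeff ((\<Prod>c<m. a (p c) c) * coeff_mon (b (p m)) e) m"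
      by (simp add: H_def lookup_dconst_mult)
    also have "\<dots> = coeff (\<Prod>c<m. a (p c) c) m * coeff (coeff_mon (b (p m)) e) 0"
    proof -
      obtain z where "coeff_mon (b (p m)) e = [:z:]"
        using deg_b[OF le[OF order_refl]] by (rule degree_eq_zeroE)
      then show ?thesis by (simp add: mult.commute)
    qed
    also have "coeff (\<Prod>c<m. a (p c) c) m = (\<Prod>c<m. coeff (a (p c) c) 1)"
      using coeff_prod_at_degree_bound[of "{..<m}" "\<lambda>c. a (p c) c"] deg_a le by auto
    also have "\<dots> * coeff (coeff_mon (b (p m)) e) 0 = (\<Prod>c<Suc m. ?B $$ (p c, c))"
      using le by (simp add: less_Suc_eq_le)
    finally show ?thesis .
  qed
  have "H (det ?A) = (\<Sum>p | p permutes {0..<Suc m}. signof p * H (\<Prod>c<Suc m. ?A $$ (p c, c)))"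
    by (subst det_col[of _ "Suc m"]) (simp_all only: mat_carrier H_sum H_sign)
  also have "\<dots> = det ?B"
    by (subst det_col[of ?B "Suc m"])
       (auto intro!: sum.cong simp only: mat_carrier H_prod mem_Collect_eq)
  finally show ?thesis by (simp only: H_def)
qed


section \<open>Coefficients of the perturbed polynomials\<close>

lemma lookup_perturbed_poly:
  "coeff_mon (perturbed_poly P \<phi> i) m
     = (dvar i 0 when m = 0) - dconst [:coeff_mon (P i) m, coeff_mon (\<phi> i) m:]"
proof -
  let ?h = "map_coeffs (\<lambda>a. [:a:])"
  have embed: "?h (x - dconst a) = ?h x - dconst [:a:]" for x :: "'a dpoly" and a
    by (rule poly_mapping_eqI)
       (simp add: coeff_mon_map_coeffs lookup_minus dconst_def lookup_single when_def)
  have dvar: "?h (dvar i 0 when m = 0) = (dvar i 0 when m = 0 :: 'a poly dpoly)"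
    by (rule poly_mapping_eqI)
       (simp add: coeff_mon_map_coeffs dvar_def lookup_single when_def one_pCons)
  have "coeff_mon (sys_poly P i) m = (dvar i 0 when m = 0) - dconst (coeff_mon (P i) m)"
    by (cases "m = 0")
       (simp_all add: sys_poly_def lookup_minus coeff_mon_map_coeffs dconst_def lookup_single)
  then have "coeff_mon (perturbed_poly P \<phi> i) m
      = ?h ((dvar i 0 when m = 0) - dconst (coeff_mon (P i) m))
        - dconst [:0, 1:] * dconst [:coeff_mon (\<phi> i) m:]"
    by (simp add: perturbed_poly_def lookup_minus coeff_mon_map_coeffs lookup_dconst_mult
        map_eq_zero_iff)
  also have "\<dots> = (dvar i 0 when m = 0)
      - dconst ([:coeff_mon (P i) m:] + [:0, 1:] * [:coeff_mon (\<phi> i) m:])"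
    unfolding embed dvar dconst_mult[symmetric] dconst_add diff_diff_eq ..
  finally show ?thesis by simp
qed


section \<open>The chain perturbation and its syzygies\<close>

text \<open>
  Here \<open>c i k\<close> is the coefficient of \<open>t\<^sup>k\<close> in the polynomial \<open>c\<^sub>i\<close> of degree at most
  \<open>(n - 1) D\<close>, and the hypotheses are \<open>t\<^sup>D c\<^sub>i + c\<^bsub>i+1\<^esub> = 0\<close> and
  \<open>t\<^sup>D c\<^bsub>n-1\<^esub> + c\<^sub>n + t\<^sup>D c\<^sub>n = 0\<close> in degrees up to \<open>n D\<close>. Divisibility by powers of \<open>t\<close> is
  propagated forwards along the chain, and vanishing backwards.
\<close>

lemma vanishing_of_chain_syzygy:
  fixes c :: "nat \<Rightarrow> nat \<Rightarrow> 'a::ab_group_add"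
  assumes n: "n \<ge> 2" and D: "D > 0"
    and deg: "\<And>i k. k > (n - 1) * D \<Longrightarrow> c i k = 0"
    and chain: "\<And>i l. 1 \<le> i \<Longrightarrow> i < n - 1 \<Longrightarrow> l \<le> n * D \<Longrightarrow>
      (if l < D then 0 else c i (l - D)) + c (Suc i) l = 0"
    and closing: "\<And>l. l \<le> n * D \<Longrightarrow>
      (if l < D then 0 else c (n - 1) (l - D)) + c n l + (if l < D then 0 else c n (l - D)) = 0"
    and top: "c n ((n - 1) * D) = 0"
    and i: "1 \<le> i" "i \<le> n"
  shows "c i k = 0"
proof -
  have nD: "n * D = (n - 1) * D + D" using n by (cases n) auto
  \<comment> \<open>\<open>c\<^bsub>i+1\<^esub>\<close> is divisible by \<open>t\<^bsup>iD\<^esup>\<close>.\<close>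
  have low: "c (Suc i) l = 0" if "Suc i \<le> n - 1" "l < i * D" for i l
    using that
  proof (induction i arbitrary: l)
    case (Suc i)
    have "Suc i * D \<le> n * D" using Suc.prems(1) by (intro mult_right_mono) auto
    then have "l \<le> n * D" using Suc.prems by linarith
    moreover have "c (Suc i) (l - D) = 0" if "\<not> l < D"
      using Suc that by (intro Suc.IH) auto
    ultimately show ?case using chain[of "Suc i" l] Suc.prems by (auto split: if_splits)
  qed simp
  have low_n1: "c (n - 1) l = 0" if "l < (n - 2) * D" for l
    using low[of "n - 2" l] that n by (simp add: Suc_diff_Suc numeral_2_eq_2)
  \<comment> \<open>Cancelling the factor \<open>1 + t\<^sup>D\<close>, which is prime to \<open>t\<close>, is the recursion
    \<open>c n l = - c n (l - D)\<close> in low degrees.\<close>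
  have low_n: "c n l = 0" if "l < (n - 1) * D" for l
    using that
  proof (induction l rule: less_induct)
    case (less l)
    have n2: "(n - 1) * D = (n - 2) * D + D"
      using n by (metis Suc_1 Suc_diff_le add.commute diff_Suc_Suc mult_Suc)
    have "c n (l - D) = 0" if "\<not> l < D"
      using less that D by (intro less.IH) auto
    moreover have "c (n - 1) (l - D) = 0" if "\<not> l < D"
      using less.prems that n2 by (intro low_n1) linarith
    moreover have "l \<le> n * D" using less.prems nD by linarith
    ultimately show ?case using closing[of l] by (cases "l < D") simp_all
  qed
  have c_n: "c n l = 0" for l
    using low_n[of l] top deg[of l n] by (cases l "(n - 1) * D" rule: linorder_cases) auto
  \<comment> \<open>The same relations, now read in degree \<open>k + D\<close>, carry the vanishing backwards.\<close>
  have "c (n - 1) k = 0" for k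
    using deg[of k] closing[of "k + D"] c_n nD by (cases "k \<le> (n - 1) * D") auto
  then have "c (n - 1 - j) k = 0" if "j < n - 1" for j k
    using that
  proof (induction j arbitrary: k)
    case (Suc j)
    show ?case
    proof (cases "k \<le> (n - 1) * D")
      case True
      have "Suc (n - 1 - Suc j) = n - 1 - j" using Suc.prems by simp
      then show ?thesis
        using Suc True nD chain[of "n - 1 - Suc j" "k + D"] by simp
    qed (use deg in simp)
  qed simp
  from this[of "n - 1 - i" k] show ?thesis
    using i c_n by (cases "i = n") auto
qed

text \<open>
  The maximum only matters for \<open>i = n\<close>, where it yields \<open>u\<^sub>1\<^bsup>(D)\<^esup>\<close>. This term forces the
  order \<open>D\<close> on the last polynomial as well, whatever the order of \<open>P n\<close>.
\<close>

definition chain_perturbation :: "nat \<Rightarrow> nat \<Rightarrow> nat \<Rightarrow> 'a::comm_ring_1 dpoly" where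
  "chain_perturbation n D i =
     dvar (max 1 (n - i)) D + (if i = 1 then 0 else dvar (Suc n - i) 0)"

lemma in_dvars_if_coeff_var: "coeff_var f j l \<noteq> 0 \<Longrightarrow> (j, l) \<in> dvars f"
  unfolding coeff_var_def dvars_def
  by (rule UN_I[of "Poly_Mapping.single (j, l) 1"]) (simp_all add: in_keys_iff)

lemma coeff_var_dvar: "coeff_var (dvar j k) j' k' = (1 when j = j' \<and> k = k')"
  unfolding coeff_var_def dvar_def lookup_single unit_monomial_eq_iff by simp

lemma coeff_var_chain_perturbation:
  "coeff_var (chain_perturbation n D i) j l =
     (1 when max 1 (n - i) = j \<and> D = l) + (1 when i \<noteq> 1 \<and> Suc n - i = j \<and> l = 0)"
proof -
  have "coeff_var (f + g) j l = coeff_var f j l + coeff_var g j l" for f g :: "'a dpoly"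
    by (simp add: coeff_var_def lookup_add)
  moreover have "coeff_var (0 :: 'a dpoly) j l = 0" by (simp add: coeff_var_def)
  ultimately show ?thesis by (auto simp: chain_perturbation_def coeff_var_dvar when_def)
qed

lemma keys_chain_perturbation:
  "Poly_Mapping.keys (chain_perturbation n D i :: 'a::comm_ring_1 dpoly) \<subseteq>
     {Poly_Mapping.single (max 1 (n - i), D) 1} \<union>
     (if i = 1 then {} else {Poly_Mapping.single (Suc n - i, 0) 1})"
  using keys_add[of "dvar (max 1 (n - i)) D :: 'a dpoly" "if i = 1 then 0 else dvar (Suc n - i) 0"]
  by (auto simp: chain_perturbation_def dvar_def split: if_splits)


section \<open>Orders and leading matrix of the perturbed system\<close>

locale chain_perturbed_system =
  fixes d :: "'k::field \<Rightarrow> 'k" and n :: nat and P :: "nat \<Rightarrow> 'k dpoly" and D :: nat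
  assumes derivation: "is_derivation d"
    and n: "n \<ge> 2"
    and P: "\<And>i. i \<in> {1..n} \<Longrightarrow> P i \<in> dpolys {1..n - 1} \<and> linear_dpoly (P i)"
    and D: "\<And>i j l. i \<in> {1..n} \<Longrightarrow> (j, l) \<in> dvars (P i) \<Longrightarrow> l < D"
    and D_pos: "D > 0"
begin

abbreviation "\<phi> \<equiv> chain_perturbation n D :: nat \<Rightarrow> 'k dpoly"
abbreviation "F \<equiv> perturbed_poly P \<phi>"
abbreviation "dR \<equiv> dderiv (map_poly d)"
abbreviation "K \<equiv> (n - 1) * D"

lemma dvars_phi:
  assumes "i \<in> {1..n}"
  shows "dvars (\<phi> i) \<subseteq> {1..n - 1} \<times> {..D}"
  using keys_chain_perturbation[where 'a = 'k, of n D i] assms n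
  by (fastforce simp: dvars_def split: if_splits)

lemma linear_phi: "linear_dpoly (\<phi> i)"
  using keys_chain_perturbation[where 'a = 'k, of n D i]
  by (force simp: linear_dpoly_def split: if_splits)

lemma linear_perturbation_phi: "linear_perturbation n \<phi>"
  using dvars_phi linear_phi unfolding linear_perturbation_def dpolys_def by fast

lemma keys_F:
  "Poly_Mapping.keys (F i) \<subseteq> insert 0 (Poly_Mapping.keys (P i) \<union> Poly_Mapping.keys (\<phi> i))"
  by (auto simp: in_keys_iff lookup_perturbed_poly dconst_def)

lemma dvars_F:
  assumes "i \<in> {1..n}"
  shows "dvars (F i) \<subseteq> {1..n - 1} \<times> {..D}"
proof -
  have "dvars (F i) \<subseteq> dvars (P i) \<union> dvars (\<phi> i)"
    using keys_F[of i] by (fastforce simp: dvars_def)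
  moreover have "dvars (P i) \<subseteq> {1..n - 1} \<times> {..D}"
    using P[OF assms] D[OF assms] by (fastforce simp: dpolys_def less_imp_le)
  ultimately show ?thesis using dvars_phi[OF assms] by blast
qed

lemma coeff_var_F:
  "coeff_var (F i) j l = - dconst [:coeff_var (P i) j l, coeff_var (\<phi> i) j l:]"
  by (simp add: coeff_var_def lookup_perturbed_poly single_eq_zero_iff)

lemma coeff_free_F: "coeff_free (F i) = dvar i 0 - dconst [:coeff_free (P i), coeff_free (\<phi> i):]"
  by (simp add: coeff_free_def lookup_perturbed_poly)

lemma coeff_var_P_top: "i \<in> {1..n} \<Longrightarrow> coeff_var (P i) j D = 0"
  using D[of i j D] in_dvars_if_coeff_var[of "P i" j D] by blast

lemma top_in_dvars_F: "(max 1 (n - i), D) \<in> dvars (F i)"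
proof -
  have "coeff_var (F i) (max 1 (n - i)) D \<noteq> 0"
    using D_pos by (simp add: coeff_var_F coeff_var_chain_perturbation dconst_def single_eq_zero_iff)
  then show ?thesis by (rule in_dvars_if_coeff_var)
qed

lemma dord_F_le:
  assumes "i \<in> {1..n}"
  shows "dord (F i) j \<le> int D"
proof -
  have sub: "{k. (j, k) \<in> dvars (F i)} \<subseteq> {..D}" using dvars_F[OF assms] by auto
  then have "finite {k. (j, k) \<in> dvars (F i)}" by (rule finite_subset) simp
  then show ?thesis using sub by (auto simp: dord_def)
qed

lemma dord_F_max:
  assumes "i \<in> {1..n}"
  shows "dord (F i) (max 1 (n - i)) = int D"
proof -
  let ?S = "{k. (max 1 (n - i), k) \<in> dvars (F i)}"
  have sub: "?S \<subseteq> {..D}" using dvars_F[OF assms] by auto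
  then have "Max ?S = D"
    using top_in_dvars_F[of i] by (intro Max_eqI) (auto intro: finite_subset)
  then show ?thesis using top_in_dvars_F[of i] by (auto simp: dord_def)
qed

lemma lead_ord_F:
  assumes "i \<in> {1..n}"
  shows "lead_ord n (F i) = int D"
  unfolding lead_ord_def
proof (rule Max_eqI)
  have "max 1 (n - i) \<in> {1..n - 1}" using assms n by auto
  then show "int D \<in> insert 0 (dord (F i) ` {1..n - 1})"
    using dord_F_max[OF assms] by (metis imageI insertCI)
qed (use dord_F_le[OF assms] in auto)

lemma gam_F:
  assumes "j \<in> {1..n - 1}"
  shows "gam n F j = 0"
proof (rule antisym)
  have i: "n - j \<in> {1..n}" "max 1 (n - (n - j)) = j" using assms by auto
  have "gam n F j \<le> lead_ord n (F (n - j)) - dord (F (n - j)) j"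
    unfolding gam_def using i(1) by (intro Min_le) auto
  then show "gam n F j \<le> 0"
    using lead_ord_F[OF i(1)] dord_F_max[OF i(1)] i(2) by simp
qed (rule gam_nonneg[OF assms n])

lemma gam_sum_F: "gam_sum n F = 0"
  by (simp add: gam_sum_def gam_F)

lemma ord_sum_F: "ord_sum n F = int (n * D)"
  by (simp add: ord_sum_def lead_ord_F)

lemma dcres_defined_F: "dcres_defined n F"
proof -
  have "linear_dpoly (F i)" if "i \<in> {1..n}" for i
    using keys_F[of i] P[OF that] linear_phi[of i] by (fastforce simp: linear_dpoly_def)
  moreover have "F i \<in> dpolys {1..n - 1}" if "i \<in> {1..n}" for i
    using dvars_F[OF that] by (auto simp: dpolys_def)
  moreover have "int D \<le> int (n * D)" using n by (simp del: of_nat_mult)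
  ultimately show ?thesis
    by (simp add: dcres_defined_def gam_sum_F ord_sum_F lead_ord_F)
qed

text \<open>
  The entries are coefficients of derivatives of order \<open>D\<close>. These do not occur in \<open>P\<close>, and for
  \<open>i < n\<close> the only one in \<open>\<phi>\<^sub>i\<close> is that of \<open>u\<^bsub>n-i\<^esub>\<close>.
\<close>

lemma det_leading_mat_F: "det (leading_mat_del_last n F) \<noteq> 0"
proof -
  let ?p = "- dconst [:0, 1:] :: 'k poly dpoly"
  have "leading_mat_del_last n F = ?p \<cdot>\<^sub>m 1\<^sub>m (n - 1)"
  proof (rule eq_matI)
    fix r c assume rc: "r < dim_row (?p \<cdot>\<^sub>m 1\<^sub>m (n - 1))" "c < dim_col (?p \<cdot>\<^sub>m 1\<^sub>m (n - 1))"
    then have i: "Suc r \<in> {1..n}" "n - Suc c \<in> {1..n - 1}" by auto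
    have "n - Suc r = n - Suc c \<longleftrightarrow> r = c" using rc by auto
    moreover have "max 1 (n - Suc r) = n - Suc r" using rc by auto
    ultimately show "leading_mat_del_last n F $$ (r, c) = (?p \<cdot>\<^sub>m 1\<^sub>m (n - 1)) $$ (r, c)"
      using rc D_pos lead_ord_F[OF i(1)] gam_F[OF i(2)] coeff_var_P_top[OF i(1)]
      by (simp add: leading_mat_del_last_def leading_mat_def coeff_var_F
          coeff_var_chain_perturbation dconst_def)
  qed (simp_all add: leading_mat_del_last_def)
  then show ?thesis by (simp add: dconst_def single_eq_zero_iff)
qed


section \<open>Rows and columns of the resultant matrix\<close>

text \<open>
  Naming the row of \<open>\<partial>\<^sup>k F\<^sub>i\<close> by \<open>(i, k)\<close> instead of its position lets a vector indexed by
  rows be read as a family of polynomials.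
\<close>

definition row_index :: "(nat \<times> nat) list" where
  "row_index = [(i, k). i \<leftarrow> [1..<Suc n], k \<leftarrow> rev [0..<Suc K]]"

lemma dcres_rows_F: "dcres_rows dR n F = map (\<lambda>(i, k). (dderiv dR ^^ k) (F i)) row_index"
proof -
  have "nat (ord_sum n F - lead_ord n (F i) - gam_sum n F + 1) = Suc ((n - 1) * D)"
    if "i \<in> {1..n}" for i
  proof -
    have "n * D = (n - 1) * D + D" using n by (cases n) auto
    then have "int (n * D) - int D - 0 + 1 = int (Suc ((n - 1) * D))" by linarith
    then show ?thesis
      unfolding ord_sum_F gam_sum_F lead_ord_F[OF that] by (simp only: nat_int)
  qed
  then show ?thesis
    unfolding dcres_rows_def row_index_def map_concat map_map comp_def
    by (intro arg_cong[of _ _ concat] map_cong refl) (simp_all del: upt_Suc)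
qed

lemma set_row_index: "set row_index = {1..n} \<times> {..K}"
  by (auto simp: row_index_def image_iff less_Suc_eq_le simp del: upt_Suc)

lemma distinct_row_index: "distinct row_index"
  unfolding row_index_def
  by (auto intro!: distinct_concat inj_onI simp: distinct_map simp del: upt_Suc)
     (auto simp: list_eq_iff_nth_eq)

lemma length_row_index: "length row_index = Suc (length (dcres_cols n F))"
  using length_dcres_rows[OF dcres_defined_F, of dR] length_dcres_cols[OF dcres_defined_F n]
  by (simp add: dcres_rows_F)

lemma set_dcres_cols_F: "set (dcres_cols n F) = {1..n - 1} \<times> {..n * D}"
  by (auto simp: set_dcres_cols[OF n] ord_sum_F gam_sum_F gam_F simp del: of_nat_mult)

lemma d_0 [simp]: "d 0 = 0"
  by (rule is_derivation_0[OF derivation])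

lemma d_add: "d (a + b) = d a + d b" and d_mult: "d (a * b) = d a * b + a * d b"
  using derivation unfolding is_derivation_def by blast+

lemma d_1 [simp]: "d 1 = 0"
  using d_mult[of 1 1] unfolding mult_1_left mult_1_right by (metis add_cancel_left_left)

lemma d_minus [simp]: "d (- a) = - d a"
  using d_add[of a "- a"] by (simp add: eq_neg_iff_add_eq_0 add.commute)

lemma dR_0 [simp]: "dR 0 = 0"
  by (simp add: dderiv_def)

lemma derivation_poly: "is_derivation (map_poly d)"
  by (rule is_derivation_map_poly[OF derivation])

lemma derivation_dR: "is_derivation dR"
  by (rule is_derivation_dderiv[OF derivation_poly])

lemma d_coeff_var_phi: "d (coeff_var (\<phi> i) j l) = 0"
  by (simp add: coeff_var_chain_perturbation d_add when_def)

text \<open>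
  Derivatives of \<open>P\<close> contribute only to the constant part in \<open>p\<close>. In the part linear in \<open>p\<close>
  the coefficients of \<open>\<phi>\<^sub>i\<close> have derivative 0, so there each derivation is a mere shift of the
  orders.
\<close>

lemma coeff_var_iterate_F:
  "\<exists>q. coeff_var ((dderiv dR ^^ k) (F i)) j l = dconst q \<and> degree q \<le> 1 \<and>
       coeff q 1 = - (if l < k then 0 else coeff_var (\<phi> i) j (l - k))"
proof (induction k arbitrary: l)
  case 0
  let ?q = "- [:coeff_var (P i) j l, coeff_var (\<phi> i) j l:]"
  have "degree ?q \<le> 1"
    unfolding degree_minus by (rule degree_le) (auto simp: coeff_pCons split: nat.splits)
  moreover have "coeff_var (F i) j l = dconst ?q"
    by (simp only: coeff_var_F dconst_def single_uminus)
  moreover have "coeff ?q 1 = - coeff_var (\<phi> i) j l" by simp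
  ultimately show ?case by (intro exI[of _ ?q]) simp
next
  case (Suc k)
  have step: "\<exists>q'. dR (dconst q) = dconst q' \<and> degree q' \<le> 1 \<and> coeff q' 1 = d (coeff q 1)"
    if "degree q \<le> 1" for q
  proof (intro exI conjI)
    show "degree (map_poly d q) \<le> 1"
      using that by (intro degree_le) (simp add: coeff_map_poly coeff_eq_0)
  qed (simp_all add: dderiv_dconst[OF derivation_poly] coeff_map_poly)
  obtain q where q: "coeff_var ((dderiv dR ^^ k) (F i)) j l = dconst q" "degree q \<le> 1"
      "coeff q 1 = - (if l < k then 0 else coeff_var (\<phi> i) j (l - k))"
    using Suc.IH by blast
  obtain q' where q': "dR (dconst q) = dconst q'" "degree q' \<le> 1" "coeff q' 1 = 0"
    using step[OF q(2)] q(3) d_coeff_var_phi by (auto split: if_splits)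
  show ?case
  proof (cases "l = 0")
    case True
    then show ?thesis using q(1) q' by (auto simp: coeff_var_dderiv)
  next
    case False
    obtain s where s: "coeff_var ((dderiv dR ^^ k) (F i)) j (l - 1) = dconst s" "degree s \<le> 1"
        "coeff s 1 = - (if l - 1 < k then 0 else coeff_var (\<phi> i) j (l - 1 - k))"
      using Suc.IH by blast
    show ?thesis
      using False q(1) q' s
      by (intro exI[of _ "q' + s"])
         (auto simp: coeff_var_dderiv dconst_def single_add intro: degree_add_le)
  qed
qed

lemma coeff_free_iterate_F:
  "\<exists>q. coeff_free ((dderiv dR ^^ k) (F i)) = dvar i k - dconst q"
proof (induction k)
  case (Suc k)
  then obtain q where q: "coeff_free ((dderiv dR ^^ k) (F i)) = dvar i k - dconst q" by blast
  have diff: "dR (x - y) = dR x - dR y" for x y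
  proof -
    have "dR ((x - y) + y) = dR (x - y) + dR y"
      using derivation_dR unfolding is_derivation_def by blast
    then show ?thesis by simp
  qed
  show ?case
    by (auto simp: coeff_free_dderiv q diff dderiv_dvar[OF derivation_poly]
        dderiv_dconst[OF derivation_poly])
qed (auto simp: coeff_free_F)


section \<open>Nonvanishing of the resultant\<close>

text \<open>
  Collecting the terms of a relation between the rows at the variable \<open>u\<^bsub>j,l\<^esub>\<close> gives the
  relation of the chain with \<open>i = n - j\<close> in degree \<open>l\<close>: the contributions come from
  \<open>u\<^sub>j\<^bsup>(D)\<^esup>\<close> in \<open>\<phi>\<^bsub>n-j\<^esub>\<close>, from \<open>u\<^sub>j\<close> in \<open>\<phi>\<^bsub>n-j+1\<^esub>\<close> and, if \<open>j = 1\<close>, from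
  \<open>u\<^sub>1\<^bsup>(D)\<^esup>\<close> in \<open>\<phi>\<^sub>n\<close>.
\<close>

lemma syzygy_of_phi_vanishes:
  fixes c :: "nat \<Rightarrow> nat \<Rightarrow> 'k"
  assumes rel: "\<And>j l. j \<in> {1..n - 1} \<Longrightarrow> l \<le> n * D \<Longrightarrow>
      (\<Sum>(i, k)\<in>{1..n} \<times> {..K}. (if l < k then 0 else coeff_var (\<phi> i) j (l - k)) * c i k) = 0"
    and top: "c n K = 0"
    and i: "i \<in> {1..n}" "k \<le> K"
  shows "c i k = 0"
proof -
  \<comment> \<open>Extension by zero turns the finite family into polynomials of degree at most \<open>K\<close>.\<close>
  define c' where "c' i k = (if k \<le> K then c i k else 0)" for i k
  have row: "(\<Sum>k\<le>K. (if l < k then 0 else coeff_var (\<phi> i) j (l - k)) * c i k)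
      = (if max 1 (n - i) = j \<and> D \<le> l then c' i (l - D) else 0)
        + (if i \<noteq> 1 \<and> Suc n - i = j then c' i l else 0)" for i j l
  proof -
    have "(if l < k then 0 else coeff_var (\<phi> i) j (l - k)) * c i k
        = (if k = l - D then (if max 1 (n - i) = j \<and> D \<le> l then c i k else 0) else 0)
        + (if k = l then (if i \<noteq> 1 \<and> Suc n - i = j then c i k else 0) else 0)" for k
    proof (cases "k \<le> l")
      case True
      then have "D = l - k \<longleftrightarrow> k = l - D \<and> D \<le> l" "l - k = 0 \<longleftrightarrow> k = l"
        using D_pos by auto
      then show ?thesis
        using True by (simp add: coeff_var_chain_perturbation when_def distrib_right)
    qed simp
    then show ?thesis
      by (simp add: sum.distrib c'_def)
  qed
  have rel': "(\<Sum>i\<in>{i \<in> {1..n}. max 1 (n - i) = j \<and> D \<le> l}. c' i (l - D))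
      + (\<Sum>i\<in>{i \<in> {1..n}. i \<noteq> 1 \<and> Suc n - i = j}. c' i l) = 0"
    if "j \<in> {1..n - 1}" "l \<le> n * D" for j l
    using rel[OF that]
    by (simp only: sum.cartesian_product[symmetric] row sum.distrib sum.inter_filter
        finite_atLeastAtMost)
  have "c' i k = 0"
  proof (rule vanishing_of_chain_syzygy[OF n D_pos])
    fix i l assume i: "1 \<le> i" "i < n - 1" and l: "l \<le> n * D"
    have first: "{i' \<in> {1..n}. max 1 (n - i') = n - i \<and> D \<le> l} = (if l < D then {} else {i})"
      using i by auto
    have second: "{i' \<in> {1..n}. i' \<noteq> 1 \<and> Suc n - i' = n - i} = {Suc i}"
      using i by auto
    have "n - i \<in> {1..n - 1}" using i by auto
    from rel'[OF this l, unfolded first second]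
    show "(if l < D then 0 else c' i (l - D)) + c' (Suc i) l = 0"
      by (cases "l < D") simp_all
  next
    fix l assume l: "l \<le> n * D"
    have first: "{i \<in> {1..n}. max 1 (n - i) = 1 \<and> D \<le> l} = (if l < D then {} else {n - 1, n})"
      using n by auto
    have second: "{i \<in> {1..n}. i \<noteq> 1 \<and> Suc n - i = 1} = {n}"
      using n by auto
    have "1 \<in> {1..n - 1}" "n - 1 \<noteq> n" using n by auto
    from rel'[OF this(1) l, unfolded first second] this(2)
    show "(if l < D then 0 else c' (n - 1) (l - D)) + c' n l
        + (if l < D then 0 else c' n (l - D)) = 0"
      by (cases "l < D") (simp_all add: add.assoc add.commute[of "c' n l"])
  qed (use top i in \<open>auto simp: c'_def\<close>)
  then show ?thesis using i by (simp add: c'_def)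
qed

text \<open>
  The coefficient of \<open>x\<^bsub>n,K\<^esub> p\<^sup>m\<close> is the determinant of \<open>?B\<close>, which is nonzero because a row
  relation of \<open>?B\<close> is a syzygy of \<open>\<phi>\<close> whose coefficient at \<open>\<partial>\<^sup>K \<phi>\<^sub>n\<close> vanishes.
\<close>

lemma dcres_F_nonzero: "dcres dR n F \<noteq> 0"
proof -
  define m where "m = length (dcres_cols n F)"
  define col where "col c = dcres_cols n F ! c" for c
  define row where "row r = row_index ! r" for r
  \<comment> \<open>The variable \<open>x\<^bsub>n,K\<^esub>\<close> as a monomial.\<close>
  define e where "e = Poly_Mapping.single (n, K) (1::nat)"
  define g where "g r = (dderiv dR ^^ snd (row r)) (F (fst (row r)))" for r
  \<comment> \<open>The entries of the first \<open>m\<close> columns are free of \<open>X\<close>; \<open>a r c\<close> is such an entry in \<open>\<K>[p]\<close>.\<close>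
  define a where "a r c = coeff_mon (coeff_var (g r) (fst (col c)) (snd (col c))) 0" for r c
  define s where "s = (\<lambda>(i, k) (j, l). if l < k then 0 else coeff_var (\<phi> i) j (l - k))"
  have s_eq: "s (i, k) (j, l) = (if l < k then 0 else coeff_var (\<phi> i) j (l - k))" for i k j l
    by (simp add: s_def)
  have a: "coeff_var (g r) (fst (col c)) (snd (col c)) = dconst (a r c) \<and>
      degree (a r c) \<le> 1 \<and> coeff (a r c) 1 = - s (row r) (col c)" for r c
  proof -
    obtain q where "coeff_var (g r) (fst (col c)) (snd (col c)) = dconst q" "degree q \<le> 1"
        "coeff q 1 = - s (row r) (col c)"
      using coeff_var_iterate_F[of "snd (row r)" "fst (row r)" "fst (col c)" "snd (col c)"]
      unfolding g_def s_def by (auto simp: case_prod_beta)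
    moreover from this have "a r c = q" by (simp add: a_def dconst_def)
    ultimately show ?thesis by simp
  qed
  have b: "coeff_mon (coeff_free (g r)) e = (1 when row r = (n, K))" for r
  proof -
    obtain i k where ik: "row r = (i, k)" by fastforce
    obtain q where q: "coeff_free (g r) = dvar i k - dconst q"
      using coeff_free_iterate_F[of k i] ik unfolding g_def by auto
    have "coeff_mon (dvar i k) e = (1 when (i, k) = (n, K))"
      by (simp only: dvar_def e_def lookup_single unit_monomial_eq_iff)
    moreover have "e \<noteq> 0" by (simp add: e_def single_eq_zero_iff)
    then have "coeff_mon (dconst q) e = 0"
      unfolding dconst_def by (metis lookup_single_not_eq)
    ultimately show ?thesis by (simp add: q ik lookup_minus)
  qed
  let ?B = "mat (Suc m) (Suc m)
    (\<lambda>(r, c). if c < m then - s (row r) (col c) else (1::'k) when row r = (n, K))"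
  have dim: "dcres_dim n F = Suc m"
    using length_dcres_cols[OF dcres_defined_F n] by (simp add: m_def)
  let ?A = "mat (Suc m) (Suc m)
    (\<lambda>(r, c). if c < m then dconst (a r c) else coeff_free (g r))"
  have "dcres_mat dR n F = ?A"
  proof (rule eq_matI)
    fix r c assume "r < dim_row (?A)"
      "c < dim_col (?A)"
    then have rc: "r < Suc m" "c < Suc m" by auto
    have "dcres_rows dR n F ! r = g r"
      using rc length_row_index by (simp add: dcres_rows_F g_def row_def m_def case_prod_beta)
    then show "dcres_mat dR n F $$ (r, c) = ?A $$ (r, c)"
      using rc a[of r c] by (simp add: dcres_mat_def dim Let_def col_def)
  qed (simp_all add: dcres_mat_def dim Let_def)
  then have "coeff (coeff_mon (dcres dR n F) e) m
      = det (mat (Suc m) (Suc m)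
          (\<lambda>(r, c). if c < m then coeff (a r c) 1 else coeff (coeff_mon (coeff_free (g r)) e) 0))"
    unfolding dcres_def using a by (simp add: coeff_det_const_columns b when_def)
  also have "mat (Suc m) (Suc m)
      (\<lambda>(r, c). if c < m then coeff (a r c) 1 else coeff (coeff_mon (coeff_free (g r)) e) 0) = ?B"
    by (rule eq_matI) (use a in \<open>auto simp: b when_def\<close>)
  finally have coeff: "coeff (coeff_mon (dcres dR n F) e) m = det ?B" .
  have "det ?B \<noteq> 0"
  proof
    assume "det ?B = 0"
    then have "det (transpose_mat ?B) = 0" by (subst det_transpose[of _ "Suc m"]) auto
    then obtain v where v: "v \<in> carrier_vec (Suc m)" "v \<noteq> 0\<^sub>v (Suc m)"
        "transpose_mat ?B *\<^sub>v v = 0\<^sub>v (Suc m)"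
      using det_0_iff_vec_prod_zero[of "transpose_mat ?B" "Suc m"] by auto
    have ker: "(\<Sum>r<Suc m. ?B $$ (r, c) * v $ r) = 0" if "c < Suc m" for c
      using arg_cong[OF v(3), of "\<lambda>w. w $ c"] that v(1)
      by (simp add: scalar_prod_def atLeast0LessThan del: sum.lessThan_Suc)
    have bij: "bij_betw row {..<Suc m} ({1..n} \<times> {..K})"
      using bij_betw_nth[OF distinct_row_index] length_row_index
      by (simp add: set_row_index row_def[abs_def] m_def)
    define x where "x i k = v $ inv_into {..<Suc m} row (i, k)" for i k
    have x_row: "v $ r = x (fst (row r)) (snd (row r))" if "r < Suc m" for r
      using bij that by (simp add: x_def bij_betw_def)
    have sum_row: "(\<Sum>r<Suc m. h (row r) * v $ r)
        = (\<Sum>(i, k)\<in>{1..n} \<times> {..K}. h (i, k) * x i k)" for h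
      using sum.reindex_bij_betw[OF bij, of "\<lambda>(i, k). h (i, k) * x i k"]
      by (simp add: x_row case_prod_beta del: sum.lessThan_Suc)
    have "x i k = 0" if ik: "i \<in> {1..n}" "k \<le> K" for i k
    proof (rule syzygy_of_phi_vanishes[OF _ _ ik])
      fix j l assume "j \<in> {1..n - 1}" "l \<le> n * D"
      then have "(j, l) \<in> set (dcres_cols n F)" by (simp add: set_dcres_cols_F)
      then obtain c where c: "c < m" "col c = (j, l)"
        unfolding in_set_conv_nth m_def col_def by blast
      have "0 = (\<Sum>r<Suc m. - s (row r) (j, l) * v $ r)"
        using ker[of c] c by (simp del: sum.lessThan_Suc)
      also have "\<dots> = - (\<Sum>r<Suc m. s (row r) (j, l) * v $ r)"
        by (simp only: sum_negf mult_minus_left)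
      finally show "(\<Sum>(i, k)\<in>{1..n} \<times> {..K}.
          (if l < k then 0 else coeff_var (\<phi> i) j (l - k)) * x i k) = 0"
        using sum_row[of "\<lambda>y. s y (j, l)"] by (simp add: s_eq del: sum.lessThan_Suc)
    next
      \<comment> \<open>The relation at the last column.\<close>
      have "0 = (\<Sum>r<Suc m. (1 when row r = (n, K)) * v $ r)"
        using ker[of m] by (simp del: sum.lessThan_Suc)
      also have "\<dots> = (\<Sum>y\<in>{1..n} \<times> {..K}. if y = (n, K) then x n K else 0)"
        unfolding sum_row[of "\<lambda>y. 1 when y = (n, K)"]
        by (rule sum.cong) (auto simp: when_def split: if_splits)
      also have "\<dots> = x n K" using n by simp
      finally show "x n K = 0" by simp
    qed
    then have "v $ r = 0" if "r < Suc m" for r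
      using x_row[OF that] bij_betwE[OF bij] that by (auto simp: mem_Times_iff)
    then show False using v(1,2) by (auto intro: eq_vecI)
  qed
  then show ?thesis using coeff by auto
qed

lemma dcres_F_in_dpolys: "dcres dR n F \<in> dpolys {1..n}"
proof -
  define L where "L = dcres_dim n F"
  have L: "L = length row_index" "L = Suc (length (dcres_cols n F))"
    using length_row_index length_dcres_cols[OF dcres_defined_F n] by (simp_all add: L_def)
  show ?thesis
    unfolding dcres_def
  proof (rule det_in_dpolys)
    show "dcres_mat dR n F \<in> carrier_mat L L" by (simp add: dcres_mat_def L_def Let_def)
    fix r c assume rc: "r < L" "c < L"
    obtain i k where ik: "row_index ! r = (i, k)" by fastforce
    have i: "i \<in> {1..n}"
      using nth_mem[of r row_index] rc L ik by (simp add: set_row_index)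
    have row: "dcres_rows dR n F ! r = (dderiv dR ^^ k) (F i)"
      using rc L ik by (simp add: dcres_rows_F)
    have "coeff_free ((dderiv dR ^^ k) (F i)) \<in> dpolys {1..n}"
      using coeff_free_iterate_F[of k i]
        dpolys_add[OF dpolys_dvar[OF i] dpolys_uminus[OF dpolys_dconst]]
      by (auto simp: diff_conv_add_uminus simp del: add_uminus_conv_diff)
    moreover have "coeff_var ((dderiv dR ^^ k) (F i)) j l \<in> dpolys {1..n}" for j l
      using coeff_var_iterate_F[of k i j l] dpolys_dconst by auto
    ultimately show "dcres_mat dR n F $$ (r, c) \<in> dpolys {1..n}"
      using rc by (simp add: dcres_mat_def Let_def row flip: L_def)
  qed
qed

end


section \<open>Existence of the perturbation\<close>

lemma exists_order_bound:
  fixes P :: "nat \<Rightarrow> 'a::zero dpoly"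
  shows "\<exists>D>0. \<forall>i\<in>{1..n}. \<forall>j l. (j, l) \<in> dvars (P i) \<longrightarrow> l < D"
proof -
  let ?S = "\<Union>i\<in>{1..n}. snd ` dvars (P i)"
  have "finite (dvars f)" for f :: "'a dpoly" by (simp add: dvars_def)
  then have "finite ?S" by simp
  then have "\<forall>l\<in>?S. l < Suc (Max ?S)" by (simp add: less_Suc_eq_le)
  then show ?thesis by (intro exI[of _ "Suc (Max ?S)"]) force
qed

theorem theorem6p2:
  fixes d :: "'k::field \<Rightarrow> 'k"
    and n :: nat
    and P :: "nat \<Rightarrow> 'k dpoly"
  assumes "is_derivation d"
    and "n \<ge> 2"
    and "linear_dppe n P"
    and "\<forall>j\<in>{1..n - 1}. \<exists>i\<in>{1..n}. dord (sys_poly P i) j \<ge> 0"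
  shows "\<exists>\<phi>. linear_perturbation n \<phi> \<and>
           dcres_defined n (perturbed_poly P \<phi>) \<and>
           dcres (dderiv (map_poly d)) n (perturbed_poly P \<phi>) \<in> dpolys {1..n} \<and>
           dcres (dderiv (map_poly d)) n (perturbed_poly P \<phi>) \<noteq> 0 \<and>
           det (leading_mat_del_last n (perturbed_poly P \<phi>)) \<noteq> 0"
proof -
  obtain D where "D > 0" "\<forall>i\<in>{1..n}. \<forall>j l. (j, l) \<in> dvars (P i) \<longrightarrow> l < D"
    using exists_order_bound[of n P] by blast
  then interpret chain_perturbed_system d n P D
    using assms(1-3) by unfold_locales (auto simp: linear_dppe_def)
  show ?thesis
    using linear_perturbation_phi dcres_defined_F dcres_F_in_dpolys dcres_F_nonzero
      det_leading_mat_F by blast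
qed

end
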